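(* Let $k \in \mathbb{Z}$, $r\in\mathbb{Z}$ and $n \geq 0$. Then \begin{equation*} C_{n}^{(k)}(x)=\sum_{m=0}^{n}\left\{(-1)^{m}\sum_{l=0}^{n-m}\sum_{a=0}^{n-m-l}\binom{n}{l+m}\binom{n-m-l}{a} S_{1}(l+m,m)\beta_{a}^{(r)}(-r)C_{n-m-l-a}^{(k)} \right\}B_{m}^{(r)}(x). \end{equation*}
   Context: For $k\in\mathbb{Z}$, $Lif_k(t)=\sum_{m=0}^{\infty}\frac{t^m}{m!(m+1)^k}$; the poly-Cauchy polynomials are defined by $\frac{Lif_k(\log(1+t))}{(1+t)^x}=\sum_{n\ge0} C_n^{(k)}(x)\frac{t^n}{n!}$ and $C_n^{(k)}=C_n^{(k)}(0)$. The Stirling numbers of the first kind are defined by $(\log(1+t))^m=m!\sum_{l\ge m}S_1(l,m)\frac{t^l}{l!}$. The Bernoulli polynomials of order $r$ are defined by $\left(\frac{t}{e^t-1}\right)^r e^{xt}=\sum_{n\ge0}B_n^{(r)}(x)\frac{t^n}{n!}$. Carlitz's polynomials $\beta_n^{(r)}(x)$ are defined by $\left(\frac{t}{\log(1+t)}\right)^r(1+t)^x=\sum_{n\ge0}\beta_n^{(r)}(x)\frac{t^n}{n!}$. *)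

theory Defs
  imports "HOL-Computational_Algebra.Formal_Power_Series"
begin

unbundle fps_syntax

text \<open>
  All generating functions are formal power series over an arbitrary field of characteristic 0.
  In the library, \<open>fps_ln 1\<close> is \<open>log (1 + t)\<close>, \<open>fps_binomial x\<close> is \<open>(1 + t)\<^sup>x\<close>, \<open>fps_exp x\<close> is
  \<open>e\<^sup>x\<^sup>t\<close>, and \<open>oo\<close> is composition. The polynomials are given through their values at \<open>x\<close>.
\<close>

definition Lif :: "int \<Rightarrow> 'a::field_char_0 fps" where
  "Lif k = Abs_fps (\<lambda>m. 1 / (fact m * of_nat (m + 1) powi k))"

definition poly_cauchy :: "int \<Rightarrow> nat \<Rightarrow> 'a::field_char_0 \<Rightarrow> 'a" where
  "poly_cauchy k n x = fact n * ((Lif k oo fps_ln 1) / fps_binomial x) $ n"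

definition poly_cauchy_number :: "int \<Rightarrow> nat \<Rightarrow> 'a::field_char_0" where
  "poly_cauchy_number k n = poly_cauchy k n 0"

definition stirling_first :: "nat \<Rightarrow> nat \<Rightarrow> 'a::field_char_0" where
  "stirling_first l m = fact l / fact m * (fps_ln 1 ^ m) $ l"

text \<open>
  The quotients \<open>t / (e\<^sup>t - 1)\<close> and \<open>t / log (1 + t)\<close> have constant term 1, so they are units and
  their integer powers are again power series.
\<close>

definition bernoulli_order :: "int \<Rightarrow> nat \<Rightarrow> 'a::field_char_0 \<Rightarrow> 'a" where
  "bernoulli_order r n x = fact n * (((fps_X / (fps_exp 1 - 1)) powi r) * fps_exp x) $ n"

definition carlitz_beta :: "int \<Rightarrow> nat \<Rightarrow> 'a::field_char_0 \<Rightarrow> 'a" where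
  "carlitz_beta r n x = fact n * (((fps_X / fps_ln 1) powi r) * fps_binomial x) $ n"

lemma poly_cauchy_gf:
  "(Lif k oo fps_ln 1) / fps_binomial x = Abs_fps (\<lambda>n. poly_cauchy k n x / fact n)"
  by (simp add: fps_eq_iff poly_cauchy_def)

lemma stirling_first_gf:
  "fps_ln 1 ^ m =
     fps_const (fact m) * Abs_fps (\<lambda>l. if m \<le> l then stirling_first l m / fact l else 0)"
proof (rule fps_ext)
  fix l
  have "(fps_ln (1::'a) ^ m) $ l = 0" if "l < m"
    using that by (intro startsby_zero_power_prefix[rule_format]) auto
  then show "(fps_ln (1::'a) ^ m) $ l =
     (fps_const (fact m) * Abs_fps (\<lambda>l. if m \<le> l then stirling_first l m / fact l else 0)) $ l"
    by (auto simp: stirling_first_def)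
qed

lemma bernoulli_order_gf:
  "((fps_X / (fps_exp 1 - 1)) powi r) * fps_exp x = Abs_fps (\<lambda>n. bernoulli_order r n x / fact n)"
  by (simp add: fps_eq_iff bernoulli_order_def)

lemma carlitz_beta_gf:
  "((fps_X / fps_ln 1) powi r) * fps_binomial x = Abs_fps (\<lambda>n. carlitz_beta r n x / fact n)"
  by (simp add: fps_eq_iff carlitz_beta_def)

lemma fps_X_div_exp_nth_0: "(fps_X / (fps_exp (1::'a::field_char_0) - 1)) $ 0 = 1"
proof -
  have "subdegree (fps_exp (1::'a) - 1) = 1"
    by (intro subdegreeI) auto
  then show ?thesis
    using fps_divide_nth_base[of "fps_exp (1::'a) - 1" fps_X] by simp
qed

lemma fps_X_div_ln_nth_0: "(fps_X / fps_ln (1::'a::field_char_0)) $ 0 = 1"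
proof -
  have "subdegree (fps_ln (1::'a)) = 1"
    by (intro subdegreeI) (auto simp: fps_ln_nth)
  then show ?thesis
    using fps_divide_nth_base[of "fps_ln (1::'a)" fps_X] by (simp add: fps_ln_nth)
qed

end

theory Submission
  imports Defs
begin

text \<open>
  Put \<open>L = log (1 + t)\<close>. Substituting \<open>-L\<close> for \<open>t\<close> in the generating function of the
  \<open>B\<^sub>m\<^sup>(\<^sup>r\<^sup>)(x)\<close> gives \<open>(L (1 + t) / t)\<^sup>r (1 + t)\<^sup>-\<^sup>x\<close>. The first factor is the reciprocal of the generating
  function \<open>(t / L)\<^sup>r (1 + t)\<^sup>-\<^sup>r\<close> of the \<open>\<beta>\<^sub>a\<^sup>(\<^sup>r\<^sup>)(-r)\<close>. Multiplying both by \<open>Lif\<^sub>k(L)\<close> leaves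
  \<open>Lif\<^sub>k(L) (1 + t)\<^sup>-\<^sup>x\<close>; the theorem compares coefficients, the powers \<open>(-L)\<^sup>m / m!\<close> contributing the
  Stirling numbers.
\<close>

lemma fps_power_int_mult_distrib:
  fixes f g :: "'a::field fps"
  shows "(f * g) powi r = f powi r * g powi r"
  by (simp add: power_int_def fps_inverse_mult power_mult_distrib)

lemma fps_compose_power_int:
  fixes f h :: "'a::field fps"
  assumes "h $ 0 = 0" and "f $ 0 \<noteq> 0"
  shows "(f powi r) oo h = (f oo h) powi r"
  using assms by (simp add: power_int_def fps_compose_power[symmetric] fps_inverse_compose)

lemma fps_inverse_binomial: "inverse (fps_binomial c) = fps_binomial (- c :: 'a::field_char_0)"
  by (rule fps_inverse_unique) (simp flip: fps_binomial_add_mult)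

lemma fps_binomial_power_int:
  "fps_binomial c powi r = fps_binomial (of_int r * c :: 'a::field_char_0)"
  by (simp add: power_int_def fps_inverse_binomial fps_binomial_power)

text \<open>Both sides solve (1 + t) y' = - c y with constant term 1, and this equation has only one
  such solution.\<close>

lemma fps_exp_compose_minus_ln:
  "fps_exp c oo - fps_ln 1 = fps_binomial (- c :: 'a::field_char_0)"
proof -
  have "fps_deriv (fps_exp c oo - fps_ln 1) =
      fps_const (- c) * (fps_exp c oo - fps_ln 1) / (1 + fps_X)"
    by (simp add: fps_compose_deriv fps_ln_deriv fps_divide_unit
        fps_const_mult_apply_left fps_const_neg[symmetric] del: fps_const_neg)
  then show ?thesis
    by (subst fps_binomial_ODE_unique'[symmetric]) simp
qed

text \<open>Since e^(-L) - 1 = - t / (1 + t), the first factor is L (1 + t) / t. This is the case r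
  = 1, x = 0 of the generating function identity; the general case arises from it by taking
  powers.\<close>

lemma fps_X_div_exp_compose_minus_ln:
  "((fps_X / (fps_exp 1 - 1)) oo - fps_ln 1) * (fps_X / fps_ln 1) * fps_binomial (- 1) =
    (1 :: 'a::field_char_0 fps)"
proof -
  define P :: "'a fps" where "P = fps_X / (fps_exp 1 - 1)"
  define Q :: "'a fps" where "Q = fps_X / fps_ln 1"
  define b :: "'a fps" where "b = fps_binomial (- 1)"
  \<comment> \<open>The divisors have no constant term, so they are not units; subdegree 1 still
    makes both divisions exact.\<close>
  have "subdegree (fps_exp (1::'a) - 1) = 1" "subdegree (fps_ln (1::'a)) = 1"
    by (auto intro!: subdegreeI simp: fps_ln_nth)
  then have "fps_exp (1::'a) - 1 dvd fps_X" "fps_ln (1::'a) dvd fps_X"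
    by (metis fps_X_neq_zero fps_dvd_iff le_refl subdegree_0 subdegree_fps_X zero_neq_one)+
  then have P: "P * (fps_exp 1 - 1) = fps_X" and Q: "Q * fps_ln 1 = fps_X"
    by (simp_all add: P_def Q_def)
  have "(P oo - fps_ln 1) * (b - 1) = (P * (fps_exp 1 - 1)) oo - fps_ln 1"
    by (simp add: fps_compose_mult_distrib fps_compose_sub_distrib fps_exp_compose_minus_ln b_def)
  also have "\<dots> = - fps_ln 1"
    by (simp add: P fps_X_fps_compose_startby0)
  finally have Pb: "(P oo - fps_ln 1) * (b - 1) = - fps_ln 1" .
  have "b * (1 + fps_X) = 1"
    by (simp add: b_def fps_binomial_minus_one inverse_mult_eq_1)
  then have "b - 1 = - (b * fps_X)"
    by (simp add: algebra_simps eq_neg_iff_add_eq_0)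
  with Pb have "(P oo - fps_ln 1) * (b * fps_X) = fps_ln 1"
    by simp
  \<comment> \<open>Multiply by \<open>Q\<close> and use \<open>Q * fps_ln 1 = fps_X\<close>; the
    common factor t, not a unit, is cancelled in the integral domain.\<close>
  then have "((P oo - fps_ln 1) * Q * b) * fps_X = 1 * fps_X"
    using Q by (metis mult.assoc mult.commute mult_1)
  then show ?thesis
    unfolding P_def Q_def b_def by (simp only: mult_cancel_right) simp
qed

lemma bernoulli_carlitz_gf_product:
  fixes x :: "'a::field_char_0"
  shows "(((fps_X / (fps_exp 1 - 1)) powi r * fps_exp x) oo - fps_ln 1) *
      ((fps_X / fps_ln 1) powi r * fps_binomial (- of_int r)) = fps_binomial (- x)"
proof -
  define P :: "'a fps" where "P = fps_X / (fps_exp 1 - 1)"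
  define Q :: "'a fps" where "Q = fps_X / fps_ln 1"
  \<comment> \<open>The argument - r of the Carlitz polynomial enters here: (1 + t)^(-r) is the r-th
    power of (1 + t)^(-1), so all three factors form one r-th power.\<close>
  have "((P powi r * fps_exp x) oo - fps_ln 1) * (Q powi r * fps_binomial (- of_int r)) =
      ((P oo - fps_ln 1) * Q * fps_binomial (- 1)) powi r * fps_binomial (- x)"
    using fps_X_div_exp_nth_0[where 'a = 'a]
    by (simp add: fps_compose_mult_distrib fps_compose_power_int fps_exp_compose_minus_ln
        fps_power_int_mult_distrib fps_binomial_power_int P_def mult_ac)
  then show ?thesis
    by (simp add: P_def Q_def fps_X_div_exp_compose_minus_ln power_int_def)
qed

text \<open>As \<open>h ^ m\<close> starts in degree m or later, one bound n on m serves all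
  coefficients up to n, and the two sums can be exchanged.\<close>

lemma fps_compose_mult_nth:
  fixes f g h :: "'a::idom fps"
  assumes "h $ 0 = 0"
  shows "((f oo h) * g) $ n = (\<Sum>m=0..n. f $ m * (h ^ m * g) $ n)"
proof -
  have "(f oo h) $ i = (\<Sum>m=0..n. f $ m * (h ^ m) $ i)" if "i \<le> n" for i
    unfolding fps_compose_nth
    using that startsby_zero_power_prefix[OF assms]
    by (intro sum.mono_neutral_left) auto
  then have "((f oo h) * g) $ n = (\<Sum>i=0..n. \<Sum>m=0..n. f $ m * (h ^ m) $ i * g $ (n - i))"
    by (simp add: fps_mult_nth sum_distrib_right)
  also have "\<dots> = (\<Sum>m=0..n. f $ m * (h ^ m * g) $ n)"
    by (subst sum.swap) (simp add: fps_mult_nth sum_distrib_left mult.assoc)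
  finally show ?thesis .
qed

lemma fps_power_mult_nth:
  fixes g h :: "'a::idom fps"
  assumes "h $ 0 = 0" and "m \<le> n"
  shows "(h ^ m * g) $ n = (\<Sum>l=0..n-m. (h ^ m) $ (l + m) * g $ (n - m - l))"
proof -
  have "(h ^ m * g) $ n = (\<Sum>i=m..n. (h ^ m) $ i * g $ (n - i))"
    unfolding fps_mult_nth
    using startsby_zero_power_prefix[OF assms(1)]
    by (intro sum.mono_neutral_right) auto
  also have "\<dots> = (\<Sum>l=0..n-m. (h ^ m) $ (l + m) * g $ (n - m - l))"
    using sum.shift_bounds_cl_nat_ivl[of "\<lambda>i. (h ^ m) $ i * g $ (n - i)" 0 m "n - m"] assms(2)
    by (simp add: add.commute)
  finally show ?thesis .
qed

text \<open>This yields the inner double sum of the theorem; the factor \<open>fact m\<close> comes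
  from the definition of the Stirling numbers.\<close>

lemma ln_power_mult_carlitz_poly_cauchy_nth:
  fixes c :: "'a::field_char_0"
  assumes "m \<le> n"
  shows "fact n * (fps_ln 1 ^ m *
      (((fps_X / fps_ln 1) powi r * fps_binomial c) * (Lif k oo fps_ln 1))) $ n =
    fact m * (\<Sum>l=0..n-m. \<Sum>a=0..n-m-l.
      of_nat (n choose (l + m)) * of_nat ((n - m - l) choose a) *
      stirling_first (l + m) m * carlitz_beta r a c * poly_cauchy_number k (n - m - l - a))"
proof -
  have F: "Lif k oo fps_ln 1 = Abs_fps (\<lambda>n. poly_cauchy_number k n / fact n :: 'a)"
    using poly_cauchy_gf[of k "0::'a"] by (simp add: poly_cauchy_number_def)
  have L: "(fps_ln (1::'a) ^ m) $ i = fact m * stirling_first i m / fact i" for i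
    by (simp add: stirling_first_def)
  \<comment> \<open>The product of the two binomials is the trinomial coefficient n! / ((l + m)! a!
    (n - m - l - a)!).\<close>
  have coeff: "fact n * (fact m * s / fact (l + m) * (b / fact a * (p / fact (n - m - l - a)))) =
      fact m * (of_nat (n choose (l + m)) * of_nat ((n - m - l) choose a) * s * b * p)"
    if "l \<le> n - m" "a \<le> n - m - l" for l a and s b p :: 'a
  proof -
    have "n - (l + m) = n - m - l" "l + m \<le> n"
      using that assms by auto
    then show ?thesis
      using that by (simp add: binomial_fact)
  qed
  show ?thesis
    unfolding carlitz_beta_gf F fps_power_mult_nth[OF fps_ln_0 assms] fps_mult_nth[of "Abs_fps _"]
      sum_distrib_left L fps_nth_Abs_fps
    by (intro sum.cong refl coeff) auto
qed

theorem theorem8: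
  fixes k r :: int and n :: nat and x :: "'a::field_char_0"
  shows "poly_cauchy k n x =
    (\<Sum>m=0..n. ((-1) ^ m *
       (\<Sum>l=0..n-m. \<Sum>a=0..n-m-l.
          of_nat (n choose (l + m)) * of_nat ((n - m - l) choose a) *
          stirling_first (l + m) m * carlitz_beta r a (- of_int r) *
          poly_cauchy_number k (n - m - l - a))) *
       bernoulli_order r m x)"
proof -
  let ?L = "fps_ln (1::'a)"
  define F where "F = Lif k oo ?L"
  define G where "G = (fps_X / (fps_exp 1 - 1)) powi r * fps_exp x"
  define K where "K = ((fps_X / ?L) powi r * fps_binomial (- of_int r)) * F"
  define S where "S m = (\<Sum>l=0..n-m. \<Sum>a=0..n-m-l.
          of_nat (n choose (l + m)) * of_nat ((n - m - l) choose a) *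
          stirling_first (l + m) m * carlitz_beta r a (- of_int r) *
          (poly_cauchy_number k (n - m - l - a) :: 'a))" for m
  have "F / fps_binomial x = F * fps_binomial (- x)"
    by (simp add: fps_divide_unit fps_inverse_binomial)
  \<comment> \<open>With Lif_k(L) absorbed into \<open>K\<close>, only the Bernoulli factor is left
    to be expanded in powers of - L.\<close>
  also have "\<dots> = (G oo - ?L) * K"
    unfolding G_def K_def
    by (subst bernoulli_carlitz_gf_product[of r x, symmetric]) (simp only: mult_ac)
  finally have "poly_cauchy k n x = fact n * ((G oo - ?L) * K) $ n"
    by (simp add: poly_cauchy_def F_def)
  also have "\<dots> = (\<Sum>m=0..n. fact n * (G $ m * ((- ?L) ^ m * K) $ n))"
    by (simp add: fps_compose_mult_nth sum_distrib_left)
  also have "\<dots> = (\<Sum>m=0..n. (- 1) ^ m * S m * bernoulli_order r m x)"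
  proof (rule sum.cong)
    fix m assume "m \<in> {0..n}"
    then have K: "fact n * (?L ^ m * K) $ n = fact m * S m"
      by (simp add: K_def F_def S_def ln_power_mult_carlitz_poly_cauchy_nth)
    have "((- ?L) ^ m * K) $ n = (- 1) ^ m * (?L ^ m * K) $ n"
      by (cases "even m") simp_all
    then have "fact n * (G $ m * ((- ?L) ^ m * K) $ n) =
        G $ m * (- 1) ^ m * (fact n * (?L ^ m * K) $ n)"
      by (simp only: mult_ac)
    \<comment> \<open>The coefficient \<open>G $ m\<close> is the Bernoulli polynomial divided by
      m!, which cancels \<open>fact m\<close>.\<close>
    also have "\<dots> = (- 1) ^ m * S m * bernoulli_order r m x"
      unfolding K by (simp add: bernoulli_order_def G_def mult_ac)
    finally show "fact n * (G $ m * ((- ?L) ^ m * K) $ n) =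
        (- 1) ^ m * S m * bernoulli_order r m x" .
  qed simp
  finally show ?thesis
    by (simp add: S_def)
qed

end
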